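(* Let $E$ be a row-finite graph and $H$ a hereditary saturated subset of $E^0$. Then, in the talented monoid $T_E$, $\langle H\rangle^\perp=\langle H^\perp\rangle$.
   Context: A graph $E=(E^0,E^1,r,s)$ is a directed graph with countable vertex set $E^0$, countable edge set $E^1$, and range and source maps $r,s:E^1\to E^0$. It is row-finite if $s^{-1}(v)$ is finite for every vertex $v$. A vertex $v$ is regular if $s^{-1}(v)\ne\varnothing$, otherwise a sink. For vertices, $u\ge v$ means there is a finite directed path (possibly of length $0$) from $u$ to $v$. $H\subseteq E^0$ is hereditary if $s(e)\in H$ implies $r(e)\in H$ for all $e\in E^1$, and saturated if for every regular vertex $v$, $r(s^{-1}(v))\subseteq H$ implies $v\in H$. For $H\subseteq E^0$, $R(H)=\{u\in E^0\mid u\ge v\text{ for some }v\in H\}$ and $H^\perp=E^0\setminus R(H)$. The talented monoid $T_E$ is the commutative monoid generated by $\{v(i)\mid v\in E^0,i\in\mathbb Z\}$ subject to $v(i)=\sum_{e\in s^{-1}(v)}r(e)(i+1)$ for all $i\in\mathbb Z$ and all regular vertices $v$; $\mathbb Z$ acts by ${}^n v(i)=v(i+n)$, and $v(0)$ is written $v$. On a commutative monoid, $a\le b$ iff $b=a+c$ for some $c$. A $\mathbb Z$-order ideal of $T_E$ is a submonoid $I$ closed under the $\mathbb Z$-action and such that $x\in I$, $y\le x$ imply $y\in I$. For $X\subseteq E^0$, $\langle X\rangle$ is the $\mathbb Z$-order ideal of $T_E$ generated by the elements $v=v(0)$, $v\in X$. For a $\mathbb Z$-order ideal $I$, $I^\perp$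 consists of $0$ together with all nonzero $a\in T_E$ such that for every nonzero $b\in I$ neither $a\le b$ nor $b\le a$. *)

theory Defs
  imports
    "HOL-Library.Multiset"
    "HOL-Library.Countable_Set"
    "HOL-Algebra.Divisibility"
    "Graph_Theory.Digraph"
begin

section \<open>Graphs\<close>

text \<open>
  The source map is \<^const>\<open>tail\<close> and the range map is \<^const>\<open>head\<close>, so
  \<open>out_arcs E v\<close> is the fibre of the source map over \<open>v\<close>.  Loops and parallel
  edges are allowed.
\<close>

locale countable_digraph = wf_digraph +
  assumes countable_verts: "countable (verts G)"
    and countable_arcs: "countable (arcs G)"

definition row_finite :: "('a, 'b) pre_digraph \<Rightarrow> bool" where
  "row_finite E \<longleftrightarrow> (\<forall>v\<in>verts E. finite (out_arcs E v))"

definition regular_vertex :: "('a, 'b) pre_digraph \<Rightarrow> 'a \<Rightarrow> bool" where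
  "regular_vertex E v \<longleftrightarrow> v \<in> verts E \<and> out_arcs E v \<noteq> {}"

definition hereditary :: "('a, 'b) pre_digraph \<Rightarrow> 'a set \<Rightarrow> bool" where
  "hereditary E H \<longleftrightarrow> (\<forall>e\<in>arcs E. tail E e \<in> H \<longrightarrow> head E e \<in> H)"

definition saturated :: "('a, 'b) pre_digraph \<Rightarrow> 'a set \<Rightarrow> bool" where
  "saturated E H \<longleftrightarrow> (\<forall>v. regular_vertex E v \<longrightarrow> head E ` out_arcs E v \<subseteq> H \<longrightarrow> v \<in> H)"

definition reach_set :: "('a, 'b) pre_digraph \<Rightarrow> 'a set \<Rightarrow> 'a set" where
  "reach_set E H = {u \<in> verts E. \<exists>v\<in>H. u \<rightarrow>\<^sup>*\<^bsub>E\<^esub> v}"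

definition vertex_perp :: "('a, 'b) pre_digraph \<Rightarrow> 'a set \<Rightarrow> 'a set" where
  "vertex_perp E H = verts E - reach_set E H"

section \<open>The talented monoid\<close>

text \<open>
  The free commutative monoid on the generators \<open>v(i)\<close> consists of the finite multisets
  of pairs \<open>(v, i)\<close>; the talented monoid is its quotient by the congruence generated by
  the defining relations.  It is written multiplicatively, so \<open>\<otimes>\<close> and \<open>\<one>\<close> are
  the addition and the zero of the usual additive notation.
\<close>

definition tm_free :: "('a, 'b) pre_digraph \<Rightarrow> ('a \<times> int) multiset set" where
  "tm_free E = {x. set_mset x \<subseteq> verts E \<times> UNIV}"

text \<open>
  The right-hand side of \<open>tm_rel\<close> is a sum over \<open>out_arcs E v\<close> with multiplicity (parallel
  edges are counted separately).  It is the intended one only if \<open>out_arcs E v\<close> is finite,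
  since \<^const>\<open>mset_set\<close> sends infinite sets to the empty multiset.
\<close>

inductive_set tm_cong ::
    "('a, 'b) pre_digraph \<Rightarrow> (('a \<times> int) multiset \<times> ('a \<times> int) multiset) set"
  for E :: "('a, 'b) pre_digraph" where
  tm_rel: "regular_vertex E v \<Longrightarrow>
    ({#(v, i)#}, image_mset (\<lambda>e. (head E e, i + 1)) (mset_set (out_arcs E v))) \<in> tm_cong E"
| tm_refl: "x \<in> tm_free E \<Longrightarrow> (x, x) \<in> tm_cong E"
| tm_sym: "(x, y) \<in> tm_cong E \<Longrightarrow> (y, x) \<in> tm_cong E"
| tm_trans: "(x, y) \<in> tm_cong E \<Longrightarrow> (y, z) \<in> tm_cong E \<Longrightarrow> (x, z) \<in> tm_cong E"
| tm_add: "(x, y) \<in> tm_cong E \<Longrightarrow> z \<in> tm_free E \<Longrightarrow> (x + z, y + z) \<in> tm_cong E"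

definition tm_class ::
    "('a, 'b) pre_digraph \<Rightarrow> ('a \<times> int) multiset \<Rightarrow> ('a \<times> int) multiset set" where
  "tm_class E x = tm_cong E `` {x}"

definition talented_monoid :: "('a, 'b) pre_digraph \<Rightarrow> ('a \<times> int) multiset set monoid" where
  "talented_monoid E =
    \<lparr>carrier = tm_free E // tm_cong E,
     mult = (\<lambda>a b. \<Union>x\<in>a. \<Union>y\<in>b. tm_class E (x + y)),
     one = tm_class E {#}\<rparr>"

definition tm_gen :: "('a, 'b) pre_digraph \<Rightarrow> 'a \<Rightarrow> int \<Rightarrow> ('a \<times> int) multiset set" where
  "tm_gen E v i = tm_class E {#(v, i)#}"

definition shift :: "int \<Rightarrow> ('a \<times> int) multiset \<Rightarrow> ('a \<times> int) multiset" where
  "shift n = image_mset (\<lambda>(v, i). (v, i + n))"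

definition tm_act ::
    "('a, 'b) pre_digraph \<Rightarrow> int \<Rightarrow> ('a \<times> int) multiset set \<Rightarrow> ('a \<times> int) multiset set" where
  "tm_act E n a = (\<Union>x\<in>a. tm_class E (shift n x))"

text \<open>The algebraic preorder of a commutative monoid is divisibility in multiplicative notation.\<close>

abbreviation tm_le ::
    "('a, 'b) pre_digraph \<Rightarrow> ('a \<times> int) multiset set \<Rightarrow> ('a \<times> int) multiset set \<Rightarrow> bool" where
  "tm_le E a b \<equiv> a divides\<^bsub>talented_monoid E\<^esub> b"

definition order_ideal :: "('a, 'b) pre_digraph \<Rightarrow> ('a \<times> int) multiset set set \<Rightarrow> bool" where
  "order_ideal E I \<longleftrightarrow>
    submonoid I (talented_monoid E) \<and>
    (\<forall>n. \<forall>x\<in>I. tm_act E n x \<in> I) \<and>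
    (\<forall>x\<in>I. \<forall>y\<in>carrier (talented_monoid E). tm_le E y x \<longrightarrow> y \<in> I)"

definition ideal_gen :: "('a, 'b) pre_digraph \<Rightarrow> 'a set \<Rightarrow> ('a \<times> int) multiset set set" where
  "ideal_gen E X = order_ideal E hull ((\<lambda>v. tm_gen E v 0) ` X)"

definition ideal_perp ::
    "('a, 'b) pre_digraph \<Rightarrow> ('a \<times> int) multiset set set \<Rightarrow> ('a \<times> int) multiset set set" where
  "ideal_perp E I =
    {\<one>\<^bsub>talented_monoid E\<^esub>} \<union>
    {a \<in> carrier (talented_monoid E). a \<noteq> \<one>\<^bsub>talented_monoid E\<^esub> \<and>
      (\<forall>b\<in>I. b \<noteq> \<one>\<^bsub>talented_monoid E\<^esub> \<longrightarrow> \<not> tm_le E a b \<and> \<not> tm_le E b a)}"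

section \<open>Well-definedness\<close>

lemma (in wf_digraph) tm_cong_carrier:
  assumes "(x, y) \<in> tm_cong G"
  shows "x \<in> tm_free G \<and> y \<in> tm_free G"
  using assms
proof induction
  case (tm_rel v i)
  have "set_mset (mset_set (out_arcs G v)) \<subseteq> out_arcs G v"
    by (cases "finite (out_arcs G v)") auto
  with tm_rel show ?case
    by (auto simp: tm_free_def regular_vertex_def)
qed (auto simp: tm_free_def)

lemma (in wf_digraph) equiv_tm_cong: "equiv (tm_free G) (tm_cong G)"
proof (rule equivI)
  show "tm_cong G \<subseteq> tm_free G \<times> tm_free G"
    using tm_cong_carrier by auto
  show "refl_on (tm_free G) (tm_cong G)"
    by (auto intro: refl_onI tm_refl)
qed (auto intro: symI transI tm_sym tm_trans)

lemma (in wf_digraph) tm_cong_add: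
  assumes "(x, x') \<in> tm_cong G" and "(y, y') \<in> tm_cong G"
  shows "(x + y, x' + y') \<in> tm_cong G"
proof -
  have "(x + y, x' + y) \<in> tm_cong G"
    using tm_add[OF assms(1)] tm_cong_carrier[OF assms(2)] by simp
  moreover have "(y + x', y' + x') \<in> tm_cong G"
    using tm_add[OF assms(2)] tm_cong_carrier[OF assms(1)] by simp
  ultimately show ?thesis
    unfolding add.commute[of y] add.commute[of y'] by (rule tm_trans)
qed

lemma (in wf_digraph) shift_cong:
  assumes "(x, y) \<in> tm_cong G"
  shows "(shift n x, shift n y) \<in> tm_cong G"
  using assms
proof induction
  case (tm_rel v i)
  then show ?case
    using tm_cong.tm_rel[of G v "i + n"]
    by (simp add: shift_def multiset.map_comp comp_def algebra_simps)
next
  case (tm_refl x)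
  then have "shift n x \<in> tm_free G"
    by (auto simp: shift_def tm_free_def)
  then show ?case
    by (rule tm_cong.tm_refl)
next
  case (tm_add x y z)
  then have "shift n z \<in> tm_free G"
    by (auto simp: shift_def tm_free_def)
  with tm_add.IH show ?case
    by (auto simp: shift_def intro: tm_cong.tm_add)
qed (blast intro: tm_sym tm_trans)+

lemma (in wf_digraph) tm_class_eq_iff:
  assumes "x \<in> tm_free G" and "y \<in> tm_free G"
  shows "tm_class G x = tm_class G y \<longleftrightarrow> (x, y) \<in> tm_cong G"
  using eq_equiv_class_iff[OF equiv_tm_cong assms] by (simp add: tm_class_def)

lemma (in wf_digraph) tm_mult_class:
  assumes "x \<in> tm_free G" and "y \<in> tm_free G"
  shows "tm_class G x \<otimes>\<^bsub>talented_monoid G\<^esub> tm_class G y = tm_class G (x + y)"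
proof -
  have eq: "tm_class G (x' + y') = tm_class G (x + y)"
    if "x' \<in> tm_class G x" "y' \<in> tm_class G y" for x' y'
    using that equiv_class_eq[OF equiv_tm_cong tm_cong_add, of x x' y y']
    by (simp add: tm_class_def)
  have "x \<in> tm_class G x" "y \<in> tm_class G y"
    using assms by (simp_all add: tm_class_def tm_refl)
  then have "(\<Union>x'\<in>tm_class G x. \<Union>y'\<in>tm_class G y. tm_class G (x' + y')) = tm_class G (x + y)"
    using eq by blast
  then show ?thesis
    by (simp add: talented_monoid_def)
qed

lemma (in wf_digraph) tm_act_class:
  assumes "x \<in> tm_free G"
  shows "tm_act G n (tm_class G x) = tm_class G (shift n x)"
proof -
  have eq: "tm_class G (shift n x') = tm_class G (shift n x)" if "x' \<in> tm_class G x" for x'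
    using that equiv_class_eq[OF equiv_tm_cong shift_cong, of x x' n]
    by (simp add: tm_class_def)
  have "x \<in> tm_class G x"
    using assms by (simp add: tm_class_def tm_refl)
  then show ?thesis
    unfolding tm_act_def using eq by blast
qed

lemma (in wf_digraph) comm_monoid_talented_monoid: "comm_monoid (talented_monoid G)"
proof -
  let ?T = "talented_monoid G"
  have car: "a \<in> carrier ?T \<longleftrightarrow> (\<exists>x\<in>tm_free G. a = tm_class G x)" for a
    by (auto simp: talented_monoid_def tm_class_def quotient_def)
  have one: "\<one>\<^bsub>?T\<^esub> = tm_class G {#}"
    by (simp add: talented_monoid_def)
  have zero_free: "{#} \<in> tm_free G"
    by (simp add: tm_free_def)
  have add_free: "x + y \<in> tm_free G" if "x \<in> tm_free G" "y \<in> tm_free G" for x y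
    using that by (simp add: tm_free_def)
  show ?thesis
  proof (rule comm_monoidI)
    fix a b
    assume "a \<in> carrier ?T" and "b \<in> carrier ?T"
    then obtain x y where xy: "x \<in> tm_free G" "y \<in> tm_free G"
      and ab: "a = tm_class G x" "b = tm_class G y"
      unfolding car by blast
    show "a \<otimes>\<^bsub>?T\<^esub> b \<in> carrier ?T"
      unfolding ab tm_mult_class[OF xy] car using add_free[OF xy] by blast
    show "a \<otimes>\<^bsub>?T\<^esub> b = b \<otimes>\<^bsub>?T\<^esub> a"
      unfolding ab tm_mult_class[OF xy] tm_mult_class[OF xy(2,1)] by (simp only: add.commute)
    fix c
    assume "c \<in> carrier ?T"
    then obtain z where z: "z \<in> tm_free G" and c: "c = tm_class G z"
      unfolding car by blast
    show "a \<otimes>\<^bsub>?T\<^esub> b \<otimes>\<^bsub>?T\<^esub> c = a \<otimes>\<^bsub>?T\<^esub> (b \<otimes>\<^bsub>?T\<^esub> c)"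
      unfolding ab c tm_mult_class[OF xy] tm_mult_class[OF xy(2) z]
        tm_mult_class[OF add_free[OF xy] z] tm_mult_class[OF xy(1) add_free[OF xy(2) z]]
      by (simp only: add.assoc)
  next
    fix a
    assume "a \<in> carrier ?T"
    then obtain x where x: "x \<in> tm_free G" and a: "a = tm_class G x"
      unfolding car by blast
    show "\<one>\<^bsub>?T\<^esub> \<otimes>\<^bsub>?T\<^esub> a = a"
      unfolding one a tm_mult_class[OF zero_free x] by simp
  next
    show "\<one>\<^bsub>?T\<^esub> \<in> carrier ?T"
      unfolding one car using zero_free by blast
  qed
qed

end

theory Submission
  imports Defs
begin

text \<open>
  The proof rests on one invariant.  A defining relation trades a vertex \<open>v\<close> for the ranges of
  the edges leaving it; if \<open>X\<close> is hereditary and saturated, then \<open>v\<close> lies in \<open>X\<close> exactly when all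
  these ranges do.  So whether a formal sum has all its vertices in \<open>X\<close> depends only on its class
  in the talented monoid, and \<open>\<langle>X\<rangle>\<close> is the set of classes of sums supported on \<open>X\<close>
  (\<open>tm_class_in_ideal_gen_iff\<close>).  For \<open>X = {}\<close> the invariant says that nonempty sums are nonzero.

  Let \<open>H\<close> be hereditary and saturated.  Then so is \<open>H\<^sup>\<bottom>\<close>, and the description applies to \<open>\<langle>H\<rangle>\<close> and
  to \<open>\<langle>H\<^sup>\<bottom>\<rangle>\<close>.  As \<open>H\<close> and \<open>H\<^sup>\<bottom>\<close> are disjoint, these two ideals meet only in zero;
  as both are closed downwards, no nonzero element of one is comparable to a nonzero element of
  the other, which gives \<open>\<langle>H\<^sup>\<bottom>\<rangle> \<subseteq> \<langle>H\<rangle>\<^sup>\<bottom>\<close>.  Conversely, a sum that is not supported on \<open>H\<^sup>\<bottom>\<close> contains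
  some \<open>v(i)\<close> with a path from \<open>v\<close> to some \<open>w \<in> H\<close>; expanding \<open>v(i)\<close> along this path exhibits a
  nonzero element \<open>w(k)\<close> of \<open>\<langle>H\<rangle>\<close> below the sum.
\<close>

definition support :: "('a \<times> int) multiset \<Rightarrow> 'a set" where
  "support x = fst ` set_mset x"

lemma support_simps [simp]:
  "support {#} = {}"
  "support {#p#} = {fst p}"
  "support (x + y) = support x \<union> support y"
  "support (add_mset p x) = insert (fst p) (support x)"
  by (auto simp: support_def)

lemma support_empty_iff [simp]: "support x = {} \<longleftrightarrow> x = {#}"
  by (simp add: support_def)

lemma support_shift [simp]: "support (shift n x) = support x"
  by (force simp: support_def shift_def image_image)

lemma tm_free_iff_support: "x \<in> tm_free E \<longleftrightarrow> support x \<subseteq> verts E"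
  by (auto simp: tm_free_def support_def)

lemma carrier_talented_monoid: "carrier (talented_monoid E) = tm_class E ` tm_free E"
  by (auto simp: talented_monoid_def tm_class_def quotient_def)

lemma one_talented_monoid: "\<one>\<^bsub>talented_monoid E\<^esub> = tm_class E {#}"
  by (simp add: talented_monoid_def)

lemma (in wf_digraph) tm_le_class_iff:
  assumes "x \<in> tm_free G" and "y \<in> tm_free G"
  shows "tm_le G (tm_class G x) (tm_class G y) \<longleftrightarrow> (\<exists>z\<in>tm_free G. (y, x + z) \<in> tm_cong G)"
proof -
  have "tm_class G y = tm_class G x \<otimes>\<^bsub>talented_monoid G\<^esub> tm_class G z \<longleftrightarrow> (y, x + z) \<in> tm_cong G"
    if "z \<in> tm_free G" for z
    using assms that by (simp add: tm_mult_class tm_class_eq_iff tm_free_def)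
  then show ?thesis
    unfolding factor_def carrier_talented_monoid by auto
qed

section \<open>Ideals generated by hereditary saturated sets\<close>

text \<open>
  Row-finiteness matters here: it makes the right-hand side of a defining relation mention the
  range of every edge leaving the vertex.
\<close>

lemma (in wf_digraph) tm_cong_support_iff:
  assumes "row_finite G" and "hereditary G X" and "saturated G X"
    and "(x, y) \<in> tm_cong G"
  shows "support x \<subseteq> X \<longleftrightarrow> support y \<subseteq> X"
  using assms(4)
proof induction
  case (tm_rel v i)
  then have "finite (out_arcs G v)"
    using assms(1) by (simp add: row_finite_def regular_vertex_def)
  then have "support (image_mset (\<lambda>e. (head G e, i + 1)) (mset_set (out_arcs G v)))
      = head G ` out_arcs G v"
    by (simp add: support_def image_image)
  moreover have "v \<in> X \<longleftrightarrow> head G ` out_arcs G v \<subseteq> X"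
    using assms(2,3) tm_rel by (auto simp: hereditary_def saturated_def)
  ultimately show ?case
    by simp
qed auto

lemma (in wf_digraph) tm_class_eq_one_iff:
  assumes "row_finite G" and "x \<in> tm_free G"
  shows "tm_class G x = \<one>\<^bsub>talented_monoid G\<^esub> \<longleftrightarrow> x = {#}"
proof
  assume "tm_class G x = \<one>\<^bsub>talented_monoid G\<^esub>"
  then have "(x, {#}) \<in> tm_cong G"
    using assms(2) by (simp add: one_talented_monoid tm_class_eq_iff tm_free_def)
  moreover have "hereditary G {}" "saturated G {}"
    by (auto simp: hereditary_def saturated_def regular_vertex_def)
  ultimately show "x = {#}"
    using tm_cong_support_iff[OF assms(1), of "{}" x "{#}"] by simp
qed (simp add: one_talented_monoid)

lemma (in wf_digraph) order_ideal_supported_classes: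
  assumes "row_finite G" and "X \<subseteq> verts G" and "hereditary G X" and "saturated G X"
  shows "order_ideal G (tm_class G ` {x. support x \<subseteq> X})" (is "order_ideal G ?I")
proof -
  have free: "x \<in> tm_free G" if "support x \<subseteq> X" for x
    using that assms(2) by (auto simp: tm_free_iff_support)
  have "submonoid ?I (talented_monoid G)"
  proof
    show "?I \<subseteq> carrier (talented_monoid G)"
      using free by (auto simp: carrier_talented_monoid)
    show "a \<otimes>\<^bsub>talented_monoid G\<^esub> b \<in> ?I" if "a \<in> ?I" "b \<in> ?I" for a b
      using that free by (auto simp: tm_mult_class)
    show "\<one>\<^bsub>talented_monoid G\<^esub> \<in> ?I"
      by (auto simp: one_talented_monoid)
  qed
  moreover have "tm_act G n a \<in> ?I" if "a \<in> ?I" for n a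
    using that free by (auto simp: tm_act_class)
  moreover have "a \<in> ?I"
    if "b \<in> ?I" "a \<in> carrier (talented_monoid G)" "tm_le G a b" for a b
  proof -
    obtain x y where x: "x \<in> tm_free G" "a = tm_class G x"
      and y: "support y \<subseteq> X" "b = tm_class G y"
      using \<open>a \<in> _\<close> \<open>b \<in> _\<close> by (auto simp: carrier_talented_monoid)
    obtain z where "(y, x + z) \<in> tm_cong G"
      using \<open>tm_le G a b\<close> x y free[OF y(1)] by (auto simp: tm_le_class_iff)
    then have "support x \<subseteq> X"
      using tm_cong_support_iff[OF assms(1,3,4)] y(1) by fastforce
    with x(2) show ?thesis
      by blast
  qed
  ultimately show ?thesis
    by (auto simp: order_ideal_def)
qed

lemma (in wf_digraph) order_ideal_contains_supported_class:
  assumes "order_ideal G I" and "(\<lambda>v. tm_gen G v 0) ` X \<subseteq> I" and "X \<subseteq> verts G"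
    and "support x \<subseteq> X"
  shows "tm_class G x \<in> I"
  using assms(4)
proof (induction x)
  case empty
  then show ?case
    using assms(1) submonoid.one_closed unfolding order_ideal_def one_talented_monoid[symmetric]
    by blast
next
  case (add p x)
  obtain v i where p: "p = (v, i)" by fastforce
  have v: "v \<in> X" and x: "tm_class G x \<in> I" and free: "{#p#} \<in> tm_free G" "x \<in> tm_free G"
    using add p assms(3) by (auto simp: tm_free_iff_support)
  have "{#(v, 0)#} \<in> tm_free G"
    using v assms(3) by (auto simp: tm_free_iff_support)
  then have "tm_act G i (tm_gen G v 0) = tm_class G {#p#}"
    by (simp add: tm_gen_def tm_act_class shift_def p)
  moreover have "tm_act G i (tm_gen G v 0) \<in> I"
    using assms(1,2) v unfolding order_ideal_def by blast
  ultimately have "tm_class G {#p#} \<in> I"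
    by simp
  then have "tm_class G {#p#} \<otimes>\<^bsub>talented_monoid G\<^esub> tm_class G x \<in> I"
    using x assms(1) submonoid.m_closed unfolding order_ideal_def by metis
  then show ?case
    using free by (simp add: tm_mult_class)
qed

lemma (in wf_digraph) ideal_gen_eq_supported_classes:
  assumes "row_finite G" and "X \<subseteq> verts G" and "hereditary G X" and "saturated G X"
  shows "ideal_gen G X = tm_class G ` {x. support x \<subseteq> X}"
  unfolding ideal_gen_def
proof (rule hull_unique)
  show "(\<lambda>v. tm_gen G v 0) ` X \<subseteq> tm_class G ` {x. support x \<subseteq> X}"
    by (auto simp: tm_gen_def)
  show "order_ideal G (tm_class G ` {x. support x \<subseteq> X})"
    by (rule order_ideal_supported_classes[OF assms])
  show "tm_class G ` {x. support x \<subseteq> X} \<subseteq> I"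
    if "(\<lambda>v. tm_gen G v 0) ` X \<subseteq> I" "order_ideal G I" for I
    using order_ideal_contains_supported_class[OF that(2,1) assms(2)] by blast
qed

text \<open>
  The previous description provides some representative supported on \<open>X\<close>; by invariance of the
  support condition every representative is.
\<close>

lemma (in wf_digraph) tm_class_in_ideal_gen_iff:
  assumes "row_finite G" and "X \<subseteq> verts G" and "hereditary G X" and "saturated G X"
    and "x \<in> tm_free G"
  shows "tm_class G x \<in> ideal_gen G X \<longleftrightarrow> support x \<subseteq> X"
proof
  assume "tm_class G x \<in> ideal_gen G X"
  then obtain y where y: "support y \<subseteq> X" "tm_class G x = tm_class G y"
    unfolding ideal_gen_eq_supported_classes[OF assms(1-4)] by blast
  then have "(x, y) \<in> tm_cong G"
    using assms(2,5) tm_class_eq_iff[of x y] by (auto simp: tm_free_iff_support)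
  with y(1) show "support x \<subseteq> X"
    using tm_cong_support_iff[OF assms(1,3,4)] by blast
next
  assume "support x \<subseteq> X"
  then show "tm_class G x \<in> ideal_gen G X"
    unfolding ideal_gen_eq_supported_classes[OF assms(1-4)] by blast
qed

section \<open>Reachability\<close>

lemma (in wf_digraph) hereditary_vertex_perp: "hereditary G (vertex_perp G H)"
  unfolding hereditary_def
proof (intro ballI impI)
  fix e
  assume e: "e \<in> arcs G" "tail G e \<in> vertex_perp G H"
  then have "tail G e \<rightarrow>\<^bsub>G\<^esub> head G e"
    by (auto simp: arcs_ends_def arc_to_ends_def)
  then have "tail G e \<rightarrow>\<^sup>*\<^bsub>G\<^esub> w" if "head G e \<rightarrow>\<^sup>*\<^bsub>G\<^esub> w" for w
    using that by (rule adj_reachable_trans)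
  with e show "head G e \<in> vertex_perp G H"
    by (auto simp: vertex_perp_def reach_set_def)
qed

text \<open>
  Let all edges leaving the regular vertex \<open>v\<close> end in \<open>H\<^sup>\<bottom>\<close>.  A path from \<open>v\<close> to \<open>H\<close> cannot start
  with one of these edges, so it has length zero and \<open>v\<close> lies in \<open>H\<close>; but then the ranges of the
  edges lie in \<open>H\<close> too, as \<open>H\<close> is hereditary.
\<close>

lemma (in wf_digraph) saturated_vertex_perp:
  assumes "hereditary G H"
  shows "saturated G (vertex_perp G H)"
  unfolding saturated_def
proof (intro allI impI)
  fix v
  assume v: "regular_vertex G v" and sub: "head G ` out_arcs G v \<subseteq> vertex_perp G H"
  have no_path: "\<not> head G e \<rightarrow>\<^sup>*\<^bsub>G\<^esub> w" if "e \<in> out_arcs G v" "w \<in> H" for e w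
  proof -
    have "head G e \<in> vertex_perp G H"
      using that(1) sub by blast
    then show ?thesis
      using that(2) by (auto simp: vertex_perp_def reach_set_def)
  qed
  have "v \<notin> H"
  proof
    assume "v \<in> H"
    obtain e where e: "e \<in> out_arcs G v"
      using v unfolding regular_vertex_def by blast
    then have "head G e \<in> H" "head G e \<rightarrow>\<^sup>*\<^bsub>G\<^esub> head G e"
      using assms \<open>v \<in> H\<close> by (auto simp: hereditary_def)
    with no_path[OF e] show False
      by blast
  qed
  moreover have "\<exists>e\<in>out_arcs G v. head G e \<rightarrow>\<^sup>*\<^bsub>G\<^esub> w" if "v \<rightarrow>\<^sup>*\<^bsub>G\<^esub> w" "v \<noteq> w" for w
    using that by (cases rule: converse_reachable_cases) (auto simp: arcs_ends_def arc_to_ends_def)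
  ultimately have "v \<notin> reach_set G H"
    using no_path by (fastforce simp: reach_set_def)
  then show "v \<in> vertex_perp G H"
    using v by (simp add: vertex_perp_def regular_vertex_def)
qed

lemma (in wf_digraph) disjoint_vertex_perp:
  assumes "H \<subseteq> verts G"
  shows "H \<inter> vertex_perp G H = {}"
  using assms by (auto simp: vertex_perp_def reach_set_def)

text \<open>
  Expanding \<open>v(i)\<close> by the defining relations along a path of length \<open>n\<close> from \<open>v\<close> to \<open>w\<close> leaves a sum
  with \<open>w(i + n)\<close> among its terms.
\<close>

lemma (in wf_digraph) reachable_imp_summand:
  assumes "row_finite G" and "v \<rightarrow>\<^sup>*\<^bsub>G\<^esub> w"
  shows "\<exists>k z. ({#(v, i)#}, {#(w, k)#} + z) \<in> tm_cong G"
  using assms(2)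
proof (induction arbitrary: i rule: converse_reachable_induct)
  case base
  then have "({#(w, i)#}, {#(w, i)#} + {#}) \<in> tm_cong G"
    by (auto intro: tm_refl simp: tm_free_iff_support)
  then show ?case
    by blast
next
  case (step v u)
  obtain e where e: "e \<in> out_arcs G v" "head G e = u"
    using step.hyps(1) by (auto simp: arcs_ends_def arc_to_ends_def)
  have v: "regular_vertex G v"
    using e by (auto simp: regular_vertex_def)
  then have "finite (out_arcs G v)"
    using assms(1) by (simp add: row_finite_def regular_vertex_def)
  then have "mset_set (out_arcs G v) = add_mset e (mset_set (out_arcs G v - {e}))"
    using e(1) by (simp add: mset_set.remove)
  then obtain r where rel: "({#(v, i)#}, {#(u, i + 1)#} + r) \<in> tm_cong G"
    using tm_rel[OF v, of i] e(2) by auto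
  then have "{#(u, i + 1)#} + r \<in> tm_free G"
    by (blast dest: tm_cong_carrier)
  then have r: "r \<in> tm_free G"
    by (simp add: tm_free_iff_support)
  obtain k z where "({#(u, i + 1)#}, {#(w, k)#} + z) \<in> tm_cong G"
    using step.IH by blast
  from tm_trans[OF rel tm_add[OF this r]] show ?case
    unfolding add.assoc by blast
qed

section \<open>Orthogonal ideals\<close>

theorem proposition3p11:
  fixes E :: "('a, 'b) pre_digraph" and H :: "'a set"
  assumes "countable_digraph E"
    and "row_finite E"
    and "H \<subseteq> verts E"
    and "hereditary E H"
    and "saturated E H"
  shows "ideal_perp E (ideal_gen E H) = ideal_gen E (vertex_perp E H)"
proof -
  interpret countable_digraph E
    by fact
  let ?T = "talented_monoid E" and ?P = "vertex_perp E H"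
  have P: "?P \<subseteq> verts E" "hereditary E ?P" "saturated E ?P"
    using hereditary_vertex_perp saturated_vertex_perp[OF assms(4)] by (auto simp: vertex_perp_def)
  note H_iff = tm_class_in_ideal_gen_iff[OF assms(2-5)]
  note P_iff = tm_class_in_ideal_gen_iff[OF assms(2) P]
  note one_iff = tm_class_eq_one_iff[OF assms(2)]
  have ideal: "order_ideal E (ideal_gen E X)" if "X \<subseteq> verts E" "hereditary E X" "saturated E X" for X
    using order_ideal_supported_classes[OF assms(2) that]
      ideal_gen_eq_supported_classes[OF assms(2) that] by simp
  have carrier: "a \<in> carrier ?T" if "order_ideal E I" "a \<in> I" for a I
    using that submonoid.subset unfolding order_ideal_def by blast
  have down: "a \<in> I" if "order_ideal E I" "b \<in> I" "a \<in> carrier ?T" "tm_le E a b" for a b I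
    using that unfolding order_ideal_def by blast
  note H_ideal = ideal[OF assms(3-5)] and P_ideal = ideal[OF P]
  have meet: "a = \<one>\<^bsub>?T\<^esub>" if a: "a \<in> ideal_gen E H" "a \<in> ideal_gen E ?P" for a
  proof -
    obtain x where x: "x \<in> tm_free E" "a = tm_class E x"
      using carrier[OF H_ideal a(1)] by (auto simp: carrier_talented_monoid)
    then have "support x \<subseteq> H \<inter> ?P"
      using a H_iff P_iff by blast
    then have "x = {#}"
      using disjoint_vertex_perp[OF assms(3)] by simp
    with x one_iff show ?thesis
      by blast
  qed
  show ?thesis
  proof
    show "ideal_gen E ?P \<subseteq> ideal_perp E (ideal_gen E H)"
    proof
      fix a
      assume a: "a \<in> ideal_gen E ?P"
      have "\<not> tm_le E a b \<and> \<not> tm_le E b a"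
        if "a \<noteq> \<one>\<^bsub>?T\<^esub>" "b \<in> ideal_gen E H" "b \<noteq> \<one>\<^bsub>?T\<^esub>" for b
        using that a meet down[OF H_ideal _ carrier[OF P_ideal]]
          down[OF P_ideal _ carrier[OF H_ideal]] by blast
      then show "a \<in> ideal_perp E (ideal_gen E H)"
        using carrier[OF P_ideal a] by (auto simp: ideal_perp_def)
    qed
    show "ideal_perp E (ideal_gen E H) \<subseteq> ideal_gen E ?P"
    proof
      fix a
      assume a: "a \<in> ideal_perp E (ideal_gen E H)"
      then have "a \<in> carrier ?T"
        by (auto simp: ideal_perp_def carrier_talented_monoid one_talented_monoid tm_free_def)
      then obtain x where x: "x \<in> tm_free E" "a = tm_class E x"
        by (auto simp: carrier_talented_monoid)
      have "support x \<subseteq> ?P"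
      proof (rule ccontr)
        assume "\<not> support x \<subseteq> ?P"
        then obtain v i where vi: "(v, i) \<in># x" "v \<notin> ?P"
          unfolding support_def by force
        moreover from vi(1) x(1) have "v \<in> verts E"
          by (auto simp: tm_free_def)
        ultimately obtain w where w: "w \<in> H" "v \<rightarrow>\<^sup>*\<^bsub>E\<^esub> w"
          by (auto simp: vertex_perp_def reach_set_def)
        obtain y where y: "x = {#(v, i)#} + y"
          using multi_member_split[OF vi(1)] by auto
        then have y_free: "y \<in> tm_free E"
          using x(1) by (simp add: tm_free_iff_support)
        obtain k z where "({#(v, i)#}, {#(w, k)#} + z) \<in> tm_cong E"
          using reachable_imp_summand[OF assms(2) w(2)] by blast
        from tm_add[OF this y_free] have expand: "(x, {#(w, k)#} + (z + y)) \<in> tm_cong E"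
          unfolding y add.assoc .
        then have "{#(w, k)#} + (z + y) \<in> tm_free E"
          by (blast dest: tm_cong_carrier)
        then have free: "{#(w, k)#} \<in> tm_free E" "z + y \<in> tm_free E"
          by (simp_all add: tm_free_iff_support)
        have "tm_le E (tm_class E {#(w, k)#}) a"
          using expand free(2) tm_le_class_iff[OF free(1) x(1)] x(2) by blast
        moreover have "tm_class E {#(w, k)#} \<in> ideal_gen E H"
          using H_iff[OF free(1)] w(1) by simp
        moreover have "tm_class E {#(w, k)#} \<noteq> \<one>\<^bsub>?T\<^esub>"
          unfolding one_iff[OF free(1)] by simp
        moreover have "a \<noteq> \<one>\<^bsub>?T\<^esub>"
          unfolding x(2) one_iff[OF x(1)] using vi(1) by force
        ultimately show False
          using a unfolding ideal_perp_def by blast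
      qed
      with x P_iff show "a \<in> ideal_gen E ?P"
        by blast
    qed
  qed
qed

end
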